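(* Let $\mathcal{X}\subseteq\mathbb{R}^d$, $\mathcal{Y}\subseteq\mathbb{R}$, let $\mathcal{H}$ be a class of functions $\mathcal{X}\to\mathcal{Y}$, let $k\ge 1$, and let $\ell:\mathcal{Y}\times\mathcal{Y}\to\mathbb{R}^+$ be a base loss that is $\mu$-Lipschitz in its second argument, i.e. $|\ell(y,y_1)-\ell(y,y_2)|\le \mu|y_1-y_2|$ for all $y,y_1,y_2\in\mathcal{Y}$. Then for any $n$ and any sample $S=\{(x_i,y_i)\}_{i=1}^n\subset\mathcal{X}\times\mathcal{Y}$ with covariate set $S_x=\{x_i\}_{i=1}^n$, $$\mathfrak{R}_S(\bar{\mathcal{H}}_k)\le k\,\mu\,\mathfrak{R}_{S_x}(\mathcal{H}).$$ Therefore also, for any distribution $\mathcal{D}$ on $\mathcal{X}\times\mathcal{Y}$, $\mathfrak{R}_n(\bar{\mathcal{H}}_k)\le k\,\mu\,\mathfrak{R}_n(\mathcal{H})$.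
   Context: The $k$-list-decodable class $\bar{\mathcal{H}}_k$ consists of all vector-valued functions $\bar h=(h_1(\cdot),\dots,h_k(\cdot)):\mathcal{X}\to\mathcal{Y}^k$ with $h_j\in\mathcal{H}$ for all $j$. The min-loss is $\mathcal{L}(y,\bar h(x))=\min_{j\in[k]}\ell(y,h_j(x))$. With $\boldsymbol\sigma=(\sigma_1,\dots,\sigma_n)$ i.i.d. Rademacher (uniform $\pm1$) variables: - the empirical Rademacher complexity of $\mathcal{H}$ is $\mathfrak{R}_{S_x}(\mathcal{H})=\frac1n\mathbb{E}_{\boldsymbol\sigma}\big[\sup_{h\in\mathcal{H}}\sum_{i=1}^n\sigma_i h(x_i)\big]$; - the empirical Rademacher complexity of the mixture class with the min-loss is $\mathfrak{R}_S(\bar{\mathcal{H}}_k)=\frac1n\mathbb{E}_{\boldsymbol\sigma}\big[\sup_{\bar h\in\bar{\mathcal{H}}_k}\sum_{i=1}^n\sigma_i\mathcal{L}(y_i,\bar h(x_i))\big]$. The Rademacher complexities are the expectations $\mathfrak{R}_n(\mathcal{H})=\mathbb{E}_{S_x\sim\mathcal{D}_x^n}[\mathfrak{R}_{S_x}(\mathcal{H})]$ and $\mathfrak{R}_n(\bar{\mathcal{H}}_k)=\mathbb{E}_{S\sim\mathcal{D}^n}[\mathfrak{R}_S(\bar{\mathcal{H}}_k)]$, where $\mathcal{D}_x$ is the marginal of $\mathcal{D}$ on $\mathcal{X}$. *)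

theory Defs
  imports "HOL-Probability.Probability"
begin

definition rademacher_pmf :: "nat \<Rightarrow> (nat \<Rightarrow> real) pmf" where
  "rademacher_pmf n = Pi_pmf {..<n} 0 (\<lambda>_. pmf_of_set {-1, 1})"

(* Expectation of an extended-real function under a finitely supported pmf.  Extended reals
   are needed because the supremum in a Rademacher complexity may be infinite. *)
definition pmf_expectation :: "'b pmf \<Rightarrow> ('b \<Rightarrow> ereal) \<Rightarrow> ereal" where
  "pmf_expectation p f = (\<Sum>x\<in>set_pmf p. ereal (pmf p x) * f x)"

lemma pmf_expectation_real:
  assumes "finite (set_pmf p)"
  shows "pmf_expectation p (\<lambda>x. ereal (f x)) = ereal (measure_pmf.expectation p f)"
proof -
  have "measure_pmf.expectation p f = (\<Sum>x\<in>set_pmf p. pmf p x * f x)"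
    using integral_measure_pmf[OF assms, of p f] by auto
  then show ?thesis
    by (simp add: pmf_expectation_def)
qed

(* The sample is z 0, ..., z (n - 1).  For n = 0 the value is 0. *)
definition empirical_rademacher :: "nat \<Rightarrow> ('a \<Rightarrow> real) set \<Rightarrow> (nat \<Rightarrow> 'a) \<Rightarrow> ereal" where
  "empirical_rademacher n F z =
     ereal (1 / real n) *
       pmf_expectation (rademacher_pmf n) (\<lambda>\<sigma>. SUP f\<in>F. ereal (\<Sum>i<n. \<sigma> i * f (z i)))"

lemma finite_set_rademacher_pmf: "finite (set_pmf (rademacher_pmf n))"
  by (auto simp: rademacher_pmf_def set_Pi_pmf intro!: finite_PiE_dflt)

lemma expectation_rademacher_pmf:
  assumes "i < n"
  shows "measure_pmf.expectation (rademacher_pmf n) (\<lambda>\<sigma>. \<sigma> i) = 0"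
proof -
  have "map_pmf (\<lambda>\<sigma>. \<sigma> i) (rademacher_pmf n) = pmf_of_set {-1, 1}"
    unfolding rademacher_pmf_def using assms by (subst Pi_pmf_component) auto
  then have "measure_pmf.expectation (rademacher_pmf n) (\<lambda>\<sigma>. \<sigma> i)
      = measure_pmf.expectation (pmf_of_set {-1, 1 :: real}) (\<lambda>s. s)"
    using integral_map_pmf[of "\<lambda>\<sigma>. \<sigma> i" "rademacher_pmf n" "\<lambda>s. s"] by simp
  also have "\<dots> = 0"
    by (subst integral_pmf_of_set) auto
  finally show ?thesis .
qed

lemma empirical_rademacher_nonneg:
  assumes "F \<noteq> {}"
  shows "0 \<le> empirical_rademacher n F z"
proof -
  obtain f where f: "f \<in> F" using assms by blast
  let ?p = "rademacher_pmf n"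
  have "measure_pmf.expectation ?p (\<lambda>\<sigma>. \<Sum>i<n. \<sigma> i * f (z i))
      = (\<Sum>i<n. measure_pmf.expectation ?p (\<lambda>\<sigma>. \<sigma> i * f (z i)))"
    by (intro Bochner_Integration.integral_sum integrable_measure_pmf_finite
        finite_set_rademacher_pmf)
  also have "\<dots> = 0"
    by (simp add: expectation_rademacher_pmf)
  finally have "0 = pmf_expectation ?p (\<lambda>\<sigma>. ereal (\<Sum>i<n. \<sigma> i * f (z i)))"
    using pmf_expectation_real[OF finite_set_rademacher_pmf, of n "\<lambda>\<sigma>. \<Sum>i<n. \<sigma> i * f (z i)"]
    by simp
  also have "\<dots> \<le> pmf_expectation ?p (\<lambda>\<sigma>. SUP f\<in>F. ereal (\<Sum>i<n. \<sigma> i * f (z i)))"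
    unfolding pmf_expectation_def
    by (intro sum_mono ereal_mult_left_mono SUP_upper f) simp
  finally show ?thesis
    by (simp add: empirical_rademacher_def)
qed

(* The map from samples to empirical complexities, a supremum over an arbitrary class, need not
   be measurable, so its expectation is taken as an upper integral.  On measurable functions
   this is the Lebesgue integral, see outer_expectation_measurable. *)
definition outer_expectation :: "'a measure \<Rightarrow> ('a \<Rightarrow> ennreal) \<Rightarrow> ennreal" where
  "outer_expectation M f =
     (INF g\<in>{g \<in> borel_measurable M. \<forall>x\<in>space M. f x \<le> g x}. \<integral>\<^sup>+ x. g x \<partial>M)"

lemma outer_expectation_measurable:
  assumes "f \<in> borel_measurable M"
  shows "outer_expectation M f = (\<integral>\<^sup>+ x. f x \<partial>M)"
  unfolding outer_expectation_def
  by (intro antisym INF_lower INF_greatest) (use assms in \<open>auto intro: nn_integral_mono\<close>)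

(* e2ennreal loses nothing for a nonempty class, by empirical_rademacher_nonneg. *)
definition rademacher :: "nat \<Rightarrow> 'a measure \<Rightarrow> ('a \<Rightarrow> real) set \<Rightarrow> ereal" where
  "rademacher n M F =
     enn2ereal (outer_expectation (Pi\<^sub>M {..<n} (\<lambda>_. M)) (\<lambda>z. e2ennreal (empirical_rademacher n F z)))"

(* Vectors in Y^k are functions nat => real, of which only the components 1, ..., k matter. *)
definition list_decodable :: "nat \<Rightarrow> ('x \<Rightarrow> real) set \<Rightarrow> ('x \<Rightarrow> nat \<Rightarrow> real) set" where
  "list_decodable k H = {hbar. \<forall>j\<in>{1..k}. (\<lambda>x. hbar x j) \<in> H}"

definition min_loss :: "(real \<Rightarrow> real \<Rightarrow> real) \<Rightarrow> nat \<Rightarrow> real \<Rightarrow> (nat \<Rightarrow> real) \<Rightarrow> real" where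
  "min_loss loss k y v = (MIN j\<in>{1..k}. loss y (v j))"

definition min_loss_class ::
  "(real \<Rightarrow> real \<Rightarrow> real) \<Rightarrow> nat \<Rightarrow> ('x \<Rightarrow> real) set \<Rightarrow> ('x \<times> real \<Rightarrow> real) set" where
  "min_loss_class loss k H = (\<lambda>hbar (x, y). min_loss loss k y (hbar x)) ` list_decodable k H"

end

(* Rewrite min(a, b) = (a + b - |a - b|) / 2.  The complexity of -|a - b| is at most that of
   a - b by Talagrand's contraction principle, hence at most the sum of the complexities of a
   and b, and so is that of min(a, b); induction gives the sum over the k components of the
   minimum.  Each component h |-> loss y (h x) is again a contraction of mu * h.  Contraction is
   shown in comparison form: a family a may be replaced by b whenever the increments of a in the
   index are dominated by those of b.  For the expected version, every measurable majorant on the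
   covariate samples pulls back along the projection, so upper integrals compare. *)

theory Submission
  imports Defs
begin

section \<open>Expectations over Rademacher signs\<close>

lemma pmf_expectation_mono:
  assumes "\<And>x. x \<in> set_pmf p \<Longrightarrow> f x \<le> g x"
  shows "pmf_expectation p f \<le> pmf_expectation p g"
  unfolding pmf_expectation_def by (intro sum_mono ereal_mult_left_mono assms) auto

lemma pmf_expectation_add:
  "pmf_expectation p (\<lambda>x. f x + g x) = pmf_expectation p f + pmf_expectation p g"
  unfolding pmf_expectation_def by (simp add: ereal_pos_distrib sum.distrib)

lemma pmf_expectation_cmult:
  assumes "0 \<le> c"
  shows "pmf_expectation p (\<lambda>x. ereal c * f x) = ereal c * pmf_expectation p f"
proof -
  \<comment> \<open>A finite nonnegative factor distributes over \<open>ereal\<close> sums even when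
    infinite values of both signs meet.\<close>
  have sum_cmult: "(\<Sum>x\<in>A. ereal c * h x) = ereal c * (\<Sum>x\<in>A. h x)" for A and h :: "'a \<Rightarrow> ereal"
    by (induction A rule: infinite_finite_induct) (use assms in \<open>simp_all add: ereal_pos_distrib\<close>)
  show ?thesis
    unfolding pmf_expectation_def sum_cmult[symmetric] by (simp add: mult.left_commute)
qed

lemma set_rademacher_pmf:
  "set_pmf (rademacher_pmf n) = PiE_dflt {..<n} 0 (\<lambda>_. {-1, 1})"
  by (auto simp: rademacher_pmf_def set_Pi_pmf PiE_dflt_def)

lemma pmf_rademacher_pmf:
  assumes "\<sigma> \<in> set_pmf (rademacher_pmf n)"
  shows "pmf (rademacher_pmf n) \<sigma> = (1 / 2) ^ n"
proof -
  have "pmf (rademacher_pmf n) \<sigma> = (\<Prod>i<n. pmf (pmf_of_set {-1, 1}) (\<sigma> i))"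
    using assms unfolding rademacher_pmf_def by (intro pmf_Pi')
      (auto simp: set_rademacher_pmf[unfolded rademacher_pmf_def] PiE_dflt_def)
  also have "\<dots> = (\<Prod>i<n. 1 / 2)"
    using assms by (intro prod.cong) (auto simp: set_rademacher_pmf PiE_dflt_def)
  finally show ?thesis by simp
qed

text \<open>Conditioning on the last sign: the support splits into two copies of the support for
  \<open>n\<close>, and every sign vector in them carries half the weight of its
  restriction.\<close>

lemma pmf_expectation_rademacher_Suc:
  "pmf_expectation (rademacher_pmf (Suc n)) F =
     pmf_expectation (rademacher_pmf n)
       (\<lambda>\<sigma>. ereal (1 / 2) * (F (\<sigma>(n := 1)) + F (\<sigma>(n := -1))))"
proof -
  let ?R = "\<lambda>n. set_pmf (rademacher_pmf n)"
  define ext where "ext s \<sigma> = \<sigma>(n := s)" for s :: real and \<sigma> :: "nat \<Rightarrow> real"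
  have inj: "inj_on (ext s) (?R n)" for s
  proof (rule inj_onI)
    fix \<sigma> \<tau> assume "\<sigma> \<in> ?R n" "\<tau> \<in> ?R n" and eq: "ext s \<sigma> = ext s \<tau>"
    \<comment> \<open>Both functions have the default value 0 at \<open>n\<close>, so overwriting
      that coordinate loses no information.\<close>
    then have "\<sigma> n = \<tau> n" by (auto simp: set_rademacher_pmf PiE_dflt_def)
    with eq show "\<sigma> = \<tau>" by (auto simp: ext_def fun_eq_iff split: if_splits)
  qed
  have ext_in: "ext s \<sigma> \<in> ?R (Suc n)" if "\<sigma> \<in> ?R n" "s \<in> {-1, 1}" for s \<sigma>
    using that by (auto simp: ext_def set_rademacher_pmf PiE_dflt_def less_Suc_eq)
  have split: "?R (Suc n) = ext 1 ` ?R n \<union> ext (-1) ` ?R n"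
  proof
    show "?R (Suc n) \<subseteq> ext 1 ` ?R n \<union> ext (-1) ` ?R n"
    proof
      fix \<sigma> assume \<sigma>: "\<sigma> \<in> ?R (Suc n)"
      then have "\<sigma>(n := 0) \<in> ?R n" "\<sigma> n \<in> {-1, 1}"
        by (auto simp: set_rademacher_pmf PiE_dflt_def)
      moreover have "\<sigma> = ext (\<sigma> n) (\<sigma>(n := 0))" by (simp add: ext_def)
      ultimately show "\<sigma> \<in> ext 1 ` ?R n \<union> ext (-1) ` ?R n" by (metis UnI1 UnI2 image_eqI insertE singletonD)
    qed
  qed (use ext_in in auto)
  have disj: "ext 1 ` ?R n \<inter> ext (-1) ` ?R n = {}"
  proof -
    have "ext 1 \<sigma> n \<noteq> ext (-1) \<tau> n" for \<sigma> \<tau>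
      by (simp add: ext_def)
    then show ?thesis by (auto dest: fun_cong[where x = n])
  qed
  have part: "(\<Sum>\<sigma>\<in>ext s ` ?R n. ereal (pmf (rademacher_pmf (Suc n)) \<sigma>) * F \<sigma>)
      = pmf_expectation (rademacher_pmf n) (\<lambda>\<sigma>. ereal (1 / 2) * F (\<sigma>(n := s)))"
    if "s \<in> {-1, 1}" for s
    unfolding pmf_expectation_def sum.reindex[OF inj] o_def
  proof (rule sum.cong)
    fix \<sigma> assume \<sigma>: "\<sigma> \<in> ?R n"
    show "ereal (pmf (rademacher_pmf (Suc n)) (ext s \<sigma>)) * F (ext s \<sigma>)
        = ereal (pmf (rademacher_pmf n) \<sigma>) * (ereal (1 / 2) * F (\<sigma>(n := s)))"
      unfolding pmf_rademacher_pmf[OF \<sigma>] pmf_rademacher_pmf[OF ext_in[OF \<sigma> that]]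
      by (cases "F (\<sigma>(n := s))") (simp_all add: ext_def)
  qed simp
  have "pmf_expectation (rademacher_pmf (Suc n)) F
      = pmf_expectation (rademacher_pmf n) (\<lambda>\<sigma>. ereal (1 / 2) * F (\<sigma>(n := 1)))
        + pmf_expectation (rademacher_pmf n) (\<lambda>\<sigma>. ereal (1 / 2) * F (\<sigma>(n := -1)))"
    using part[of 1] part[of "-1"] disj
    by (subst pmf_expectation_def) (simp add: split sum.union_disjoint finite_set_rademacher_pmf)
  then show ?thesis
    by (simp add: pmf_expectation_add[symmetric] ereal_pos_distrib)
qed

section \<open>Contraction for indexed families\<close>

text \<open>The complexity without the factor 1/n. With an index set in place of a set of functions,
  two families can be compared index by index; the sample is absorbed into \<open>u\<close>.\<close>

definition rademacher_sup :: "nat \<Rightarrow> 't set \<Rightarrow> ('t \<Rightarrow> nat \<Rightarrow> real) \<Rightarrow> ereal" where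
  "rademacher_sup n T u =
     pmf_expectation (rademacher_pmf n) (\<lambda>\<sigma>. SUP t\<in>T. ereal (\<Sum>i<n. \<sigma> i * u t i))"

text \<open>For fixed \<open>s\<close> and \<open>t\<close>, \<open>a s - a t\<close> is at most
  \<open>b s - b t\<close> or \<open>b t - b s\<close>. In the second case \<open>s\<close> and
  \<open>t\<close> trade places, which is harmless because both suprema run over \<open>T\<close>
  and \<open>G s + G t\<close> is symmetric.\<close>

lemma SUP_add_SUP_diff_le:
  fixes G a b :: "'t \<Rightarrow> real"
  assumes "\<And>s t. s \<in> T \<Longrightarrow> t \<in> T \<Longrightarrow> \<bar>a s - a t\<bar> \<le> \<bar>b s - b t\<bar>"
  shows "(SUP t\<in>T. ereal (G t + a t)) + (SUP t\<in>T. ereal (G t - a t))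
       \<le> (SUP t\<in>T. ereal (G t + b t)) + (SUP t\<in>T. ereal (G t - b t))"
proof (cases "T = {}")
  case False
  let ?R = "(SUP t\<in>T. ereal (G t + b t)) + (SUP t\<in>T. ereal (G t - b t))"
  have bound: "ereal (G s + a s) + ereal (G t - a t) \<le> ?R" if "s \<in> T" "t \<in> T" for s t
  proof (cases "b s \<ge> b t")
    case True
    then have "ereal (G s + a s) + ereal (G t - a t) \<le> ereal (G s + b s) + ereal (G t - b t)"
      using assms[OF that] by simp
    also have "\<dots> \<le> ?R" by (intro add_mono SUP_upper that)
    finally show ?thesis .
  next
    case False
    then have "ereal (G s + a s) + ereal (G t - a t) \<le> ereal (G t + b t) + ereal (G s - b s)"
      using assms[OF that] by simp
    also have "\<dots> \<le> ?R" by (intro add_mono SUP_upper that)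
    finally show ?thesis .
  qed
  \<comment> \<open>The suprema are taken one after the other: first over \<open>s\<close> with a
    real summand, then over \<open>t\<close>, where the supremum over \<open>s\<close> is a constant
    summand that must differ from \<open>-\<infinity>\<close>.\<close>
  have "(SUP s\<in>T. ereal (G s + a s)) + ereal (G t - a t) \<le> ?R" if t: "t \<in> T" for t
  proof -
    have "(SUP s\<in>T. ereal (G s + a s)) + ereal (G t - a t)
        = (SUP s\<in>T. ereal (G s + a s) + ereal (G t - a t))"
      using False by (intro SUP_ereal_add_left[symmetric]) auto
    also have "\<dots> \<le> ?R" by (intro SUP_least bound t)
    finally show ?thesis .
  qed
  moreover have "(SUP s\<in>T. ereal (G s + a s)) \<noteq> -\<infinity>"
  proof -
    obtain s where "s \<in> T" using False by blast
    then have "ereal (G s + a s) \<le> (SUP s\<in>T. ereal (G s + a s))" by (rule SUP_upper)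
    then show ?thesis by auto
  qed
  ultimately show ?thesis
    by (subst SUP_ereal_add_right[OF False, symmetric]) (auto intro: SUP_least)
qed simp

text \<open>The offset \<open>g\<close> absorbs the coordinates already processed, which lets the induction on
  \<open>n\<close> exchange one coordinate at a time.\<close>

lemma rademacher_contraction_offset:
  fixes a b :: "'t \<Rightarrow> nat \<Rightarrow> real"
  assumes "\<And>i s t. i < n \<Longrightarrow> s \<in> T \<Longrightarrow> t \<in> T \<Longrightarrow> \<bar>a s i - a t i\<bar> \<le> \<bar>b s i - b t i\<bar>"
  shows "pmf_expectation (rademacher_pmf n) (\<lambda>\<sigma>. SUP t\<in>T. ereal (g t + (\<Sum>i<n. \<sigma> i * a t i)))
       \<le> pmf_expectation (rademacher_pmf n) (\<lambda>\<sigma>. SUP t\<in>T. ereal (g t + (\<Sum>i<n. \<sigma> i * b t i)))"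
  using assms
proof (induction n arbitrary: g)
  case (Suc n)
  let ?E = "pmf_expectation (rademacher_pmf n)"
  let ?S = "\<lambda>g c \<sigma>. SUP t\<in>T. ereal (g t + (\<Sum>i<n. \<sigma> i * c t i))"
  have step: "pmf_expectation (rademacher_pmf (Suc n))
        (\<lambda>\<sigma>. SUP t\<in>T. ereal (g t + (\<Sum>i<Suc n. \<sigma> i * c t i)))
      = ereal (1 / 2) * (?E (?S (\<lambda>t. g t + c t n) c) + ?E (?S (\<lambda>t. g t - c t n) c))" for c
  proof -
    have upd: "(\<Sum>i<Suc n. (\<sigma>(n := x)) i * c t i) = (\<Sum>i<n. \<sigma> i * c t i) + x * c t n"
      for \<sigma> :: "nat \<Rightarrow> real" and x t
      by (simp add: sum.cong[where g = "\<lambda>i. (\<sigma>(n := x)) i * c t i"])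
    have "g t + ((\<Sum>i<n. \<sigma> i * c t i) + 1 * c t n) = g t + c t n + (\<Sum>i<n. \<sigma> i * c t i)"
      "g t + ((\<Sum>i<n. \<sigma> i * c t i) + - 1 * c t n) = g t - c t n + (\<Sum>i<n. \<sigma> i * c t i)"
      for \<sigma> t by simp_all
    then show ?thesis
      unfolding pmf_expectation_rademacher_Suc upd
      by (simp only:) (simp add: pmf_expectation_cmult pmf_expectation_add)
  qed
  have "?E (?S (\<lambda>t. g t + a t n) a) + ?E (?S (\<lambda>t. g t - a t n) a)
      \<le> ?E (?S (\<lambda>t. g t + a t n) b) + ?E (?S (\<lambda>t. g t - a t n) b)"
    by (intro add_mono Suc.IH Suc.prems) auto
  \<comment> \<open>Only the last coordinate still carries \<open>a\<close>, inside the offset. It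
    is exchanged for each fixed choice of the other signs.\<close>
  also have "\<dots> \<le> ?E (?S (\<lambda>t. g t + b t n) b) + ?E (?S (\<lambda>t. g t - b t n) b)"
    unfolding pmf_expectation_add[symmetric]
  proof (rule pmf_expectation_mono)
    fix \<sigma>
    show "?S (\<lambda>t. g t + a t n) b \<sigma> + ?S (\<lambda>t. g t - a t n) b \<sigma>
        \<le> ?S (\<lambda>t. g t + b t n) b \<sigma> + ?S (\<lambda>t. g t - b t n) b \<sigma>"
      using SUP_add_SUP_diff_le[of T "\<lambda>t. a t n" "\<lambda>t. b t n" "\<lambda>t. g t + (\<Sum>i<n. \<sigma> i * b t i)"]
        Suc.prems[of n] by (simp add: algebra_simps)
  qed
  finally show ?case
    unfolding step by (intro ereal_mult_left_mono) auto
qed simp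

text \<open>The induction above with zero offset. Since only increments are compared, negation,
  absolute values and Lipschitz losses are all instances.\<close>

lemma rademacher_sup_contraction:
  assumes "\<And>i s t. i < n \<Longrightarrow> s \<in> T \<Longrightarrow> t \<in> T \<Longrightarrow> \<bar>a s i - a t i\<bar> \<le> \<bar>b s i - b t i\<bar>"
  shows "rademacher_sup n T a \<le> rademacher_sup n T b"
  using rademacher_contraction_offset[where g = "\<lambda>_. 0", OF assms] by (simp add: rademacher_sup_def)

section \<open>Sums, multiples and minima of families\<close>

lemma rademacher_sup_add:
  "rademacher_sup n T (\<lambda>t i. u t i + v t i) \<le> rademacher_sup n T u + rademacher_sup n T v"
  unfolding rademacher_sup_def pmf_expectation_add[symmetric]
proof (intro pmf_expectation_mono SUP_least)
  fix \<sigma> t assume t: "t \<in> T"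
  have "ereal (\<Sum>i<n. \<sigma> i * (u t i + v t i))
      = ereal (\<Sum>i<n. \<sigma> i * u t i) + ereal (\<Sum>i<n. \<sigma> i * v t i)"
    by (simp add: distrib_left sum.distrib)
  also have "\<dots> \<le> (SUP t\<in>T. ereal (\<Sum>i<n. \<sigma> i * u t i)) + (SUP t\<in>T. ereal (\<Sum>i<n. \<sigma> i * v t i))"
    by (intro add_mono SUP_upper t)
  finally show "ereal (\<Sum>i<n. \<sigma> i * (u t i + v t i)) \<le> \<dots>" .
qed

text \<open>Equality can fail: for \<open>c = 0\<close> and empty \<open>T\<close> the left side is
  \<open>-\<infinity>\<close> and the right side 0.\<close>

lemma rademacher_sup_cmult:
  assumes "0 \<le> c"
  shows "rademacher_sup n T (\<lambda>t i. c * u t i) \<le> ereal c * rademacher_sup n T u"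
  unfolding rademacher_sup_def pmf_expectation_cmult[OF assms, symmetric]
proof (intro pmf_expectation_mono SUP_least)
  fix \<sigma> t assume t: "t \<in> T"
  have "ereal (\<Sum>i<n. \<sigma> i * (c * u t i)) = ereal c * ereal (\<Sum>i<n. \<sigma> i * u t i)"
    by (simp add: sum_distrib_left mult.left_commute)
  also have "\<dots> \<le> ereal c * (SUP t\<in>T. ereal (\<Sum>i<n. \<sigma> i * u t i))"
    using assms by (intro ereal_mult_left_mono SUP_upper t) simp
  finally show "ereal (\<Sum>i<n. \<sigma> i * (c * u t i)) \<le> \<dots>" .
qed

lemma rademacher_sup_min:
  "rademacher_sup n T (\<lambda>t i. min (u t i) (v t i)) \<le> rademacher_sup n T u + rademacher_sup n T v"
proof -
  let ?P = "rademacher_sup n T"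
  \<comment> \<open>This is the reverse triangle inequality for the differences \<open>u - v\<close>
    at two indices.\<close>
  have "?P (\<lambda>t i. - \<bar>u t i - v t i\<bar>) \<le> ?P (\<lambda>t i. u t i + (- v t i))"
    by (rule rademacher_sup_contraction) linarith
  also have "\<dots> \<le> ?P u + ?P (\<lambda>t i. - v t i)" by (rule rademacher_sup_add)
  \<comment> \<open>Negation keeps the size of increments, so contraction also supplies the sign
    symmetry.\<close>
  also have "?P (\<lambda>t i. - v t i) \<le> ?P v" by (rule rademacher_sup_contraction) linarith
  finally have diff: "?P (\<lambda>t i. - \<bar>u t i - v t i\<bar>) \<le> ?P u + ?P v" by (simp add: add_left_mono)
  have "?P (\<lambda>t i. min (u t i) (v t i))
      = ?P (\<lambda>t i. 1 / 2 * ((u t i + v t i) + - \<bar>u t i - v t i\<bar>))"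
    by (intro arg_cong[of _ _ ?P] ext) (simp add: min_def field_simps)
  also have "\<dots> \<le> ereal (1 / 2) * ?P (\<lambda>t i. (u t i + v t i) + - \<bar>u t i - v t i\<bar>)"
    by (rule rademacher_sup_cmult) simp
  also have "\<dots> \<le> ereal (1 / 2) * ((?P u + ?P v) + (?P u + ?P v))"
    by (intro ereal_mult_left_mono order_trans[OF rademacher_sup_add] add_mono
        rademacher_sup_add diff) simp
  also have "\<dots> = ?P u + ?P v" by (cases "?P u"; cases "?P v") auto
  finally show ?thesis .
qed

text \<open>Splitting off the last index reduces this to the binary minimum. The induction starts at
  1, where the minimum is over a single family.\<close>

lemma rademacher_sup_Min:
  fixes k :: nat
  assumes "k \<ge> 1"
  shows "rademacher_sup n T (\<lambda>t i. MIN j\<in>{1..k}. u j t i) \<le> (\<Sum>j\<in>{1..k}. rademacher_sup n T (u j))"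
  using assms
proof (induction k rule: dec_induct)
  case (step k)
  have "(\<lambda>t i. MIN j\<in>{1..Suc k}. u j t i) = (\<lambda>t i. min (MIN j\<in>{1..k}. u j t i) (u (Suc k) t i))"
    using step.hyps by (intro ext) (simp add: atLeastAtMostSuc_conv min.commute)
  then have "rademacher_sup n T (\<lambda>t i. MIN j\<in>{1..Suc k}. u j t i)
      \<le> rademacher_sup n T (\<lambda>t i. MIN j\<in>{1..k}. u j t i) + rademacher_sup n T (u (Suc k))"
    by (simp only: rademacher_sup_min)
  also have "\<dots> \<le> (\<Sum>j\<in>{1..k}. rademacher_sup n T (u j)) + rademacher_sup n T (u (Suc k))"
    by (rule add_right_mono) (rule step.IH)
  finally show ?case by simp
qed simp

section \<open>The empirical bound and the degenerate case\<close>

text \<open>Lets the min-loss class be treated as a family indexed by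
  \<open>list_decodable k H\<close>, on which all components live together.\<close>

lemma empirical_rademacher_image:
  "empirical_rademacher n (f ` T) z = ereal (1 / real n) * rademacher_sup n T (\<lambda>t i. f t (z i))"
  by (simp add: empirical_rademacher_def rademacher_sup_def image_image)

lemma empirical_rademacher_min_loss:
  fixes H :: "('x \<Rightarrow> real) set"
  assumes H: "H \<subseteq> X \<rightarrow> Y" and k: "k \<ge> 1" and \<mu>: "0 \<le> \<mu>"
    and lip: "\<And>y y1 y2. y \<in> Y \<Longrightarrow> y1 \<in> Y \<Longrightarrow> y2 \<in> Y \<Longrightarrow> \<bar>loss y y1 - loss y y2\<bar> \<le> \<mu> * \<bar>y1 - y2\<bar>"
    and S: "S \<in> {..<n} \<rightarrow> X \<times> Y"
  shows "empirical_rademacher n (min_loss_class loss k H) S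
       \<le> ereal (real k * \<mu>) * empirical_rademacher n H (fst \<circ> S)"
proof -
  let ?T = "list_decodable k H"
  define P where "P = rademacher_sup n H (\<lambda>h i. h (fst (S i)))"
  define u where "u j hbar i = loss (snd (S i)) (hbar (fst (S i)) j)"
    for j i and hbar :: "'x \<Rightarrow> nat \<Rightarrow> real"
  have u_le: "rademacher_sup n ?T (u j) \<le> ereal \<mu> * P" if j: "j \<in> {1..k}" for j
  proof -
    have "rademacher_sup n ?T (u j) \<le> rademacher_sup n ?T (\<lambda>hbar i. \<mu> * hbar (fst (S i)) j)"
    proof (rule rademacher_sup_contraction)
      fix i s t assume i: "i < n" and st: "s \<in> ?T" "t \<in> ?T"
      \<comment> \<open>The Lipschitz bound is available on \<open>Y\<close> only, so labels and
        predictions must be located there first.\<close>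
      have Si: "fst (S i) \<in> X" "snd (S i) \<in> Y" using S i by (auto simp: Pi_iff mem_Times_iff)
      have "(\<lambda>x. s x j) \<in> H" "(\<lambda>x. t x j) \<in> H" using st j by (auto simp: list_decodable_def)
      then have "s (fst (S i)) j \<in> Y" "t (fst (S i)) j \<in> Y" using H Si by auto
      then have "\<bar>u j s i - u j t i\<bar> \<le> \<mu> * \<bar>s (fst (S i)) j - t (fst (S i)) j\<bar>"
        using lip Si unfolding u_def by blast
      also have "\<dots> = \<bar>\<mu> * s (fst (S i)) j - \<mu> * t (fst (S i)) j\<bar>"
        using \<mu> by (simp add: abs_mult right_diff_distrib[symmetric])
      finally show "\<bar>u j s i - u j t i\<bar> \<le> \<bar>\<mu> * s (fst (S i)) j - \<mu> * t (fst (S i)) j\<bar>" .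
    qed
    also have "\<dots> \<le> ereal \<mu> * rademacher_sup n ?T (\<lambda>hbar i. hbar (fst (S i)) j)"
      by (rule rademacher_sup_cmult[OF \<mu>])
    \<comment> \<open>The \<open>j\<close>-th component of a list is a member of \<open>H\<close>,
      so the supremum over lists is at most the one over \<open>H\<close>.\<close>
    also have "\<dots> \<le> ereal \<mu> * P"
      unfolding P_def rademacher_sup_def
    proof (intro ereal_mult_left_mono pmf_expectation_mono SUP_least)
      fix \<sigma> hbar assume "hbar \<in> ?T"
      then have "(\<lambda>x. hbar x j) \<in> H" using j by (auto simp: list_decodable_def)
      then show "ereal (\<Sum>i<n. \<sigma> i * hbar (fst (S i)) j) \<le> (SUP h\<in>H. ereal (\<Sum>i<n. \<sigma> i * h (fst (S i))))"
        by (rule SUP_upper2) simp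
    qed (use \<mu> in simp)
    finally show ?thesis .
  qed
  have "empirical_rademacher n (min_loss_class loss k H) S
      = ereal (1 / real n) * rademacher_sup n ?T (\<lambda>hbar i. MIN j\<in>{1..k}. u j hbar i)"
    unfolding min_loss_class_def empirical_rademacher_image
    by (simp add: case_prod_beta min_loss_def u_def)
  also have "\<dots> \<le> ereal (1 / real n) * (\<Sum>j\<in>{1..k}. rademacher_sup n ?T (u j))"
    by (intro ereal_mult_left_mono rademacher_sup_Min k) simp
  also have "\<dots> \<le> ereal (1 / real n) * (\<Sum>j\<in>{1..k}. ereal \<mu> * P)"
    by (intro ereal_mult_left_mono sum_mono u_le) auto
  also have "(\<Sum>j\<in>{1..k}. ereal \<mu> * P) = ereal (real k * \<mu>) * P"
    using k \<mu> by (cases P) (auto simp: sum_constant_ereal zero_less_mult_iff)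
  also have "ereal (1 / real n) * (ereal (real k * \<mu>) * P)
      = ereal (real k * \<mu>) * empirical_rademacher n H (fst \<circ> S)"
    unfolding P_def empirical_rademacher_def rademacher_sup_def by (simp add: mult.left_commute)
  finally show ?thesis .
qed

text \<open>All increments on the sample vanish, so contraction compares with the zero family. An
  empty \<open>F\<close> with positive \<open>n\<close> gives \<open>-\<infinity>\<close>, hence the
  inequality.\<close>

lemma empirical_rademacher_subsingleton:
  assumes "\<And>f g i. f \<in> F \<Longrightarrow> g \<in> F \<Longrightarrow> i < n \<Longrightarrow> f (z i) = g (z i)"
  shows "empirical_rademacher n F z \<le> 0"
proof -
  have "rademacher_sup n F (\<lambda>f i. f (z i)) \<le> rademacher_sup n F (\<lambda>f i. 0 * f (z i))"
  proof (rule rademacher_sup_contraction)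
    fix i f g assume "i < n" "f \<in> F" "g \<in> F"
    then have "f (z i) = g (z i)" by (intro assms)
    then show "\<bar>f (z i) - g (z i)\<bar> \<le> \<bar>0 * f (z i) - 0 * g (z i)\<bar>" by simp
  qed
  also have "\<dots> \<le> ereal 0 * rademacher_sup n F (\<lambda>f i. f (z i))"
    by (rule rademacher_sup_cmult) simp
  finally show ?thesis
    using ereal_mult_left_mono[of _ 0 "ereal (1 / real n)"]
      empirical_rademacher_image[of n "\<lambda>f. f" F z]
    by (simp add: zero_ereal_def[symmetric])
qed

section \<open>Upper integrals and the expected complexity\<close>

text \<open>A measurable majorant \<open>h\<close> of \<open>g\<close> yields the majorant
  \<open>c * h (\<phi> x)\<close> of \<open>f\<close>, and its integral is \<open>c\<close> times
  that of \<open>h\<close> because \<open>\<phi>\<close> carries \<open>M\<close> to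
  \<open>N\<close>.\<close>

lemma outer_expectation_pullback:
  assumes \<phi>: "\<phi> \<in> measurable M N" and distr: "distr M N \<phi> = N"
    and le: "\<And>x. x \<in> space M \<Longrightarrow> f x \<le> ennreal c * g (\<phi> x)"
  shows "outer_expectation M f \<le> ennreal c * outer_expectation N g"
proof -
  have bound: "outer_expectation M f \<le> ennreal c * (\<integral>\<^sup>+ y. h y \<partial>N)"
    if h: "h \<in> borel_measurable N" and gh: "\<forall>y\<in>space N. g y \<le> h y" for h
  proof -
    have h\<phi>: "(\<lambda>x. h (\<phi> x)) \<in> borel_measurable M" using \<phi> h by measurable
    have "outer_expectation M f \<le> (\<integral>\<^sup>+ x. ennreal c * h (\<phi> x) \<partial>M)"
      unfolding outer_expectation_def
    proof (intro INF_lower CollectI conjI ballI)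
      fix x assume x: "x \<in> space M"
      have "f x \<le> ennreal c * g (\<phi> x)" by (rule le[OF x])
      also have "\<dots> \<le> ennreal c * h (\<phi> x)"
        using gh measurable_space[OF \<phi> x] by (intro mult_left_mono) auto
      finally show "f x \<le> ennreal c * h (\<phi> x)" .
    qed (use h\<phi> in measurable)
    also have "\<dots> = ennreal c * (\<integral>\<^sup>+ y. h y \<partial>distr M N \<phi>)"
      using h h\<phi> \<phi> by (simp add: nn_integral_cmult nn_integral_distr)
    finally show ?thesis by (simp add: distr)
  qed
  show ?thesis
  \<comment> \<open>If \<open>ennreal c\<close> is 0, the majorant \<open>top\<close> already gives
    the bound 0. Otherwise dividing by \<open>c\<close> moves the factor past the infimum over
    majorants.\<close>
  proof (cases "c \<le> 0")
    case True
    then show ?thesis using bound[of "\<lambda>_. top"] by (simp add: ennreal_neg)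
  next
    case False
    have "ennreal c \<noteq> 0" using False by simp
    have "outer_expectation M f / ennreal c \<le> outer_expectation N g"
      unfolding outer_expectation_def[of N]
      using False bound by (intro INF_greatest divide_le_posI_ennreal) (auto simp: mult.commute)
    then have "outer_expectation M f / ennreal c * ennreal c \<le> outer_expectation N g * ennreal c"
      by (rule mult_right_mono) simp
    also have "outer_expectation M f / ennreal c * ennreal c = outer_expectation M f * ennreal c / ennreal c"
      by (simp add: divide_ennreal_def ac_simps)
    also have "\<dots> = outer_expectation M f"
      by (rule mult_divide_eq_ennreal[OF \<open>ennreal c \<noteq> 0\<close>]) simp
    finally show ?thesis by (simp only: mult.commute)
  qed
qed

text \<open>Truncation at 0 commutes with the factor when \<open>y\<close> is nonnegative; for
  negative \<open>y\<close> also \<open>x\<close> is at most 0 and is truncated to 0.\<close>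

lemma e2ennreal_le_cmult:
  assumes "0 \<le> c" "x \<le> ereal c * y"
  shows "e2ennreal x \<le> ennreal c * e2ennreal y"
proof (cases "0 \<le> y")
  case True
  have "e2ennreal x \<le> e2ennreal (ereal c * y)" using assms(2) by (rule e2ennreal_mono)
  also have "\<dots> = ennreal c * e2ennreal y"
    using assms(1) True by (cases y) (auto simp: ennreal_mult ennreal_mult_top)
  finally show ?thesis .
next
  case False
  then have "ereal c * y \<le> 0" using assms(1) by (simp add: ereal_mult_le_0_iff)
  then show ?thesis using assms(2) by (simp add: e2ennreal_neg)
qed

text \<open>Points of the product space are undefined outside the index set, which
  \<open>compose\<close> respects; the complexity reads only the entries below
  \<open>n\<close>.\<close>

lemma empirical_rademacher_compose:
  "empirical_rademacher n F (compose {..<n} g z) = empirical_rademacher n F (g \<circ> z)"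
  by (simp add: empirical_rademacher_def compose_def)

text \<open>Applying \<open>g\<close> to every entry carries the \<open>n\<close>-fold power of
  \<open>D\<close> to the \<open>n\<close>-fold power of its image, so the sample-wise bound
  survives the passage to upper integrals.\<close>

lemma rademacher_le_distr:
  assumes D: "prob_space D" and g: "g \<in> measurable D N" and c: "0 \<le> c"
    and le: "\<And>z. z \<in> {..<n} \<rightarrow> space D \<Longrightarrow>
      empirical_rademacher n F z \<le> ereal c * empirical_rademacher n G (g \<circ> z)"
  shows "rademacher n D F \<le> ereal c * rademacher n (distr D N g) G"
proof -
  let ?N = "distr D N g"
  have meas: "g \<in> measurable D ?N" using g by simp
  have "distr (Pi\<^sub>M {..<n} (\<lambda>_. D)) (Pi\<^sub>M {..<n} (\<lambda>_. ?N)) (compose {..<n} g)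
      = Pi\<^sub>M {..<n} (\<lambda>_. distr D ?N g)"
    using prob_space.prob_space_distr[OF D g] D meas by (intro distr_PiM_finite_prob_space') auto
  also have "distr D ?N g = ?N" by (rule distr_cong) auto
  finally have distr: "distr (Pi\<^sub>M {..<n} (\<lambda>_. D)) (Pi\<^sub>M {..<n} (\<lambda>_. ?N)) (compose {..<n} g)
      = Pi\<^sub>M {..<n} (\<lambda>_. ?N)" .
  have "compose {..<n} g \<in> measurable (Pi\<^sub>M {..<n} (\<lambda>_. D)) (Pi\<^sub>M {..<n} (\<lambda>_. ?N))"
    unfolding compose_def using meas by measurable
  then have "outer_expectation (Pi\<^sub>M {..<n} (\<lambda>_. D)) (\<lambda>z. e2ennreal (empirical_rademacher n F z))
      \<le> ennreal c * outer_expectation (Pi\<^sub>M {..<n} (\<lambda>_. ?N)) (\<lambda>z. e2ennreal (empirical_rademacher n G z))"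
    using distr
  proof (rule outer_expectation_pullback)
    fix z assume "z \<in> space (Pi\<^sub>M {..<n} (\<lambda>_. D))"
    then have "z \<in> {..<n} \<rightarrow> space D" by (auto simp: space_PiM)
    from le[OF this] show "e2ennreal (empirical_rademacher n F z)
        \<le> ennreal c * e2ennreal (empirical_rademacher n G (compose {..<n} g z))"
      unfolding empirical_rademacher_compose by (rule e2ennreal_le_cmult[OF c])
  qed
  then have "rademacher n D F \<le> enn2ereal (ennreal c * outer_expectation (Pi\<^sub>M {..<n} (\<lambda>_. ?N)) (\<lambda>z. e2ennreal (empirical_rademacher n G z)))"
    unfolding rademacher_def by (simp add: less_eq_ennreal.rep_eq)
  then show ?thesis
    using c by (simp add: rademacher_def times_ennreal.rep_eq)
qed

text \<open>The constant 0 is a measurable majorant of the truncated complexities.\<close>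

lemma rademacher_eq_0:
  assumes "\<And>z. z \<in> {..<n} \<rightarrow> space M \<Longrightarrow> empirical_rademacher n F z \<le> 0"
  shows "rademacher n M F = 0"
proof -
  have "outer_expectation (Pi\<^sub>M {..<n} (\<lambda>_. M)) (\<lambda>z. e2ennreal (empirical_rademacher n F z))
      \<le> (\<integral>\<^sup>+ z. 0 \<partial>Pi\<^sub>M {..<n} (\<lambda>_. M))"
    unfolding outer_expectation_def
    using assms by (intro INF_lower) (auto simp: space_PiM PiE_iff e2ennreal_neg)
  then show ?thesis by (simp add: rademacher_def zero_ennreal.rep_eq)
qed

theorem theorem3p1:
  fixes X :: "(real ^ 'd) set" and Y :: "real set" and H :: "(real ^ 'd \<Rightarrow> real) set"
    and k :: nat and loss :: "real \<Rightarrow> real \<Rightarrow> real" and \<mu> :: real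
  assumes "H \<subseteq> X \<rightarrow> Y"
    and "k \<ge> 1"
    and "\<And>y y'. y \<in> Y \<Longrightarrow> y' \<in> Y \<Longrightarrow> 0 \<le> loss y y'"
    and "\<And>y y1 y2. y \<in> Y \<Longrightarrow> y1 \<in> Y \<Longrightarrow> y2 \<in> Y \<Longrightarrow> \<bar>loss y y1 - loss y y2\<bar> \<le> \<mu> * \<bar>y1 - y2\<bar>"
  shows "(\<forall>n. \<forall>S \<in> {..<n} \<rightarrow> X \<times> Y.
            empirical_rademacher n (min_loss_class loss k H) S
              \<le> ereal (real k * \<mu>) * empirical_rademacher n H (fst \<circ> S)) \<and>
         (\<forall>n. \<forall>D :: ((real ^ 'd) \<times> real) measure.
            prob_space D \<and> sets D = sets (restrict_space borel (X \<times> Y)) \<longrightarrow>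
            rademacher n D (min_loss_class loss k H)
              \<le> ereal (real k * \<mu>) * rademacher n (distr D (restrict_space borel X) fst) H)"
proof -
  let ?F = "min_loss_class loss k H"
  txt \<open>A negative \<open>\<mu>\<close> is possible only if \<open>Y\<close> has at most one point; then \<open>0\<close> is also a
    Lipschitz constant and the complexity of \<open>H\<close> is not positive.\<close>
  define \<nu> where "\<nu> = max 0 \<mu>"
  have \<nu>: "0 \<le> \<nu>" "0 \<le> real k * \<nu>" by (auto simp: \<nu>_def)
  have emp: "empirical_rademacher n ?F S \<le> ereal (real k * \<nu>) * empirical_rademacher n H (fst \<circ> S)"
    if "S \<in> {..<n} \<rightarrow> X \<times> Y" for n S
  proof (rule empirical_rademacher_min_loss[OF assms(1,2) \<nu>(1) _ that])
    fix y y1 y2 assume "y \<in> Y" "y1 \<in> Y" "y2 \<in> Y"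
    then have "\<bar>loss y y1 - loss y y2\<bar> \<le> \<mu> * \<bar>y1 - y2\<bar>" by (rule assms(4))
    also have "\<dots> \<le> \<nu> * \<bar>y1 - y2\<bar>" by (intro mult_right_mono) (auto simp: \<nu>_def)
    finally show "\<bar>loss y y1 - loss y y2\<bar> \<le> \<nu> * \<bar>y1 - y2\<bar>" .
  qed
  have degenerate: "empirical_rademacher n H z \<le> 0"
    if neg: "\<mu> < 0" and z: "z \<in> {..<n} \<rightarrow> X" for n z
  proof (rule empirical_rademacher_subsingleton)
    fix f g i assume "f \<in> H" "g \<in> H" "i < n"
    then have Y: "f (z i) \<in> Y" "g (z i) \<in> Y" using assms(1) z by blast+
    \<comment> \<open>The point \<open>f (z i)\<close> of \<open>Y\<close> serves as the label too;
      the left side of the Lipschitz bound is nonnegative.\<close>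
    have "0 \<le> \<mu> * \<bar>f (z i) - g (z i)\<bar>" using assms(4)[OF Y(1) Y] by linarith
    then show "f (z i) = g (z i)" using neg by (simp add: zero_le_mult_iff)
  qed
  show ?thesis
  proof (intro conjI allI ballI impI)
    fix n and S :: "nat \<Rightarrow> (real ^ 'd) \<times> real" assume S: "S \<in> {..<n} \<rightarrow> X \<times> Y"
    show "empirical_rademacher n ?F S \<le> ereal (real k * \<mu>) * empirical_rademacher n H (fst \<circ> S)"
    proof (cases "\<mu> < 0")
      case True
      have "empirical_rademacher n H (fst \<circ> S) \<le> 0"
        using S by (intro degenerate[OF True]) (auto simp: Pi_iff mem_Times_iff)
      \<comment> \<open>A product of two nonpositive factors; the left complexity is at most 0
        because here \<open>\<nu>\<close> is 0.\<close>
      then have "0 \<le> ereal (real k * \<mu>) * empirical_rademacher n H (fst \<circ> S)"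
        using True by (simp add: ereal_zero_le_0_iff mult_nonneg_nonpos)
      moreover have "empirical_rademacher n ?F S \<le> 0"
        using emp[OF S] True by (simp add: \<nu>_def zero_ereal_def[symmetric])
      ultimately show ?thesis by (rule order_trans[rotated])
    qed (use emp[OF S] in \<open>simp add: \<nu>_def\<close>)
  next
    fix n and D :: "((real ^ 'd) \<times> real) measure"
    assume "prob_space D \<and> sets D = sets (restrict_space borel (X \<times> Y))"
    then have D: "prob_space D" and sets: "sets D = sets (restrict_space borel (X \<times> Y))" by auto
    have space: "space D = X \<times> Y" using sets_eq_imp_space_eq[OF sets] by (simp add: space_restrict_space)
    \<comment> \<open>Continuity makes the projection Borel, and restricting to
      \<open>X \<times> Y\<close> and \<open>X\<close> makes the pushforward of \<open>D\<close> the
      marginal on \<open>X\<close>.\<close>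
    have "fst \<in> measurable (borel :: ((real ^ 'd) \<times> real) measure) borel"
      by (intro borel_measurable_continuous_onI continuous_on_fst continuous_on_id)
    then have "fst \<in> measurable (restrict_space borel (X \<times> Y)) (restrict_space borel X)"
      by (rule measurable_restrict_space3) auto
    then have fst: "fst \<in> measurable D (restrict_space borel X)"
      using measurable_cong_sets[OF sets refl] by blast
    let ?R = "rademacher n (distr D (restrict_space borel X) fst) H"
    have le: "rademacher n D ?F \<le> ereal (real k * \<nu>) * ?R"
      by (rule rademacher_le_distr[OF D fst \<nu>(2)]) (rule emp, simp add: space)
    show "rademacher n D ?F \<le> ereal (real k * \<mu>) * ?R"
    proof (cases "\<mu> < 0")
      case True
      \<comment> \<open>Truncation turns the nonpositive complexities into exactly 0, so the sign of
        \<open>\<mu>\<close> no longer affects the right side.\<close>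
      then have "?R = 0"
        by (intro rademacher_eq_0 degenerate) (auto simp: space_restrict_space)
      then show ?thesis using le by simp
    qed (use le in \<open>simp add: \<nu>_def\<close>)
  qed
qed

end
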